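(* Let $\mathcal{H}$ be a complex Hilbert space. For $T\in\mathcal{B}(\mathcal{H})$ and $q\in[0,1]$ the following relation holds: $$\omega_q^2(T)\le \frac{q^2}{2}\,\|T^*T+TT^*\|+\left(1-q^2+q\sqrt{1-q^2}\right)\|T\|^2 .$$
   Context: $\mathcal{B}(\mathcal{H})$ denotes the bounded linear operators on the complex Hilbert space $\mathcal{H}$, $\|\cdot\|$ the operator norm, and $T^*$ the adjoint of $T$. For $q\in[0,1]$, the $q$-numerical radius of $T$ is $\omega_q(T)=\sup\{|\langle Tx,y\rangle| : x,y\in\mathcal{H},\ \|x\|=\|y\|=1,\ \langle x,y\rangle=q\}$, and $\omega_q^2(T)=(\omega_q(T))^2$. The supremum over the empty set (which occurs only when $\dim\mathcal{H}=0$, or $\dim\mathcal{H}=1$ and $q<1$) is read as $0$. *)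

theory Defs
  imports "HOL-Analysis.Analysis"
begin

class complex_vector = real_vector +
  fixes scaleC :: "complex \<Rightarrow> 'a \<Rightarrow> 'a" (infixr \<open>*\<^sub>C\<close> 75)
  assumes scaleC_add_right: "c *\<^sub>C (x + y) = c *\<^sub>C x + c *\<^sub>C y"
    and scaleC_add_left: "(c + d) *\<^sub>C x = c *\<^sub>C x + d *\<^sub>C x"
    and scaleC_scaleC: "c *\<^sub>C d *\<^sub>C x = (c * d) *\<^sub>C x"
    and scaleC_one: "1 *\<^sub>C x = x"
    and scaleR_scaleC: "r *\<^sub>R x = complex_of_real r *\<^sub>C x"

text \<open>The inner product is linear in the first and conjugate-linear in the second argument.\<close>

class complex_inner = complex_vector + real_normed_vector +
  fixes cinner :: "'a \<Rightarrow> 'a \<Rightarrow> complex"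
  assumes cinner_commute: "cinner x y = cnj (cinner y x)"
    and cinner_add_left: "cinner (x + y) z = cinner x z + cinner y z"
    and cinner_scaleC_left: "cinner (c *\<^sub>C x) y = c * cinner x y"
    and cinner_ge_zero: "0 \<le> Re (cinner x x)"
    and cinner_eq_zero_iff: "cinner x x = 0 \<longleftrightarrow> x = 0"
    and norm_eq_sqrt_cinner: "norm x = sqrt (Re (cinner x x))"

class chilbert_space = complex_inner + banach

instantiation complex :: chilbert_space
begin

definition scaleC_complex :: "complex \<Rightarrow> complex \<Rightarrow> complex"
  where "scaleC_complex c x = c * x"

definition cinner_complex :: "complex \<Rightarrow> complex \<Rightarrow> complex"
  where "cinner_complex x y = x * cnj y"

instance
  by standard
    (auto simp: scaleC_complex_def cinner_complex_def algebra_simps scaleR_conv_of_real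
      cmod_def power2_eq_square)

end

instantiation vec :: (chilbert_space, finite) chilbert_space
begin

definition scaleC_vec :: "complex \<Rightarrow> 'a ^ 'b \<Rightarrow> 'a ^ 'b"
  where "scaleC_vec c x = (\<chi> i. c *\<^sub>C x $ i)"

definition cinner_vec :: "'a ^ 'b \<Rightarrow> 'a ^ 'b \<Rightarrow> complex"
  where "cinner_vec x y = (\<Sum>i\<in>UNIV. cinner (x $ i) (y $ i))"

instance
proof
  fix x y z :: "'a ^ 'b" and c d :: complex and r :: real
  have sq: "(norm u)\<^sup>2 = Re (cinner u u)" for u :: 'a
    by (simp add: norm_eq_sqrt_cinner cinner_ge_zero)
  have im: "Im (cinner u u) = 0" for u :: 'a
    using arg_cong[OF cinner_commute[of u u], of Im] by simp
  show "c *\<^sub>C (x + y) = c *\<^sub>C x + c *\<^sub>C y" "(c + d) *\<^sub>C x = c *\<^sub>C x + d *\<^sub>C x"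
    "c *\<^sub>C d *\<^sub>C x = (c * d) *\<^sub>C x" "1 *\<^sub>C x = x" "r *\<^sub>R x = complex_of_real r *\<^sub>C x"
    by (simp_all add: scaleC_vec_def vec_eq_iff scaleC_add_right scaleC_add_left
        scaleC_scaleC scaleC_one scaleR_scaleC)
  show "cinner x y = cnj (cinner y x)"
    unfolding cinner_vec_def cnj_sum by (intro sum.cong refl cinner_commute)
  show "cinner (x + y) z = cinner x z + cinner y z"
    by (simp add: cinner_vec_def cinner_add_left sum.distrib)
  show "cinner (c *\<^sub>C x) y = c * cinner x y"
    by (simp add: cinner_vec_def scaleC_vec_def cinner_scaleC_left sum_distrib_left)
  show nn: "0 \<le> Re (cinner x x)"
    by (simp add: cinner_vec_def sum_nonneg cinner_ge_zero)
  show n: "norm x = sqrt (Re (cinner x x))"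
    by (simp add: cinner_vec_def norm_vec_def L2_set_def sq)
  show "cinner x x = 0 \<longleftrightarrow> x = 0"
  proof
    assume "cinner x x = 0"
    then show "x = 0" using n by simp
  next
    assume "x = 0"
    then show "cinner x x = 0" by (simp add: cinner_vec_def cinner_eq_zero_iff)
  qed
qed

end

definition bounded_clinear :: "('a::complex_inner \<Rightarrow> 'b::complex_inner) \<Rightarrow> bool"
  where "bounded_clinear T \<longleftrightarrow> bounded_linear T \<and> (\<forall>c x. T (c *\<^sub>C x) = c *\<^sub>C T x)"

text \<open>Meaningful for bounded operators on a Hilbert space, where the adjoint exists and is unique.\<close>

definition cadjoint :: "('a::chilbert_space \<Rightarrow> 'a) \<Rightarrow> 'a \<Rightarrow> 'a"
  where "cadjoint T = (THE S. \<forall>x y. cinner (T x) y = cinner x (S y))"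

text \<open>The supremum over the empty set is read as \<open>0\<close>; \<open>Sup {}\<close> is unspecified on the reals.\<close>

definition q_numerical_radius :: "real \<Rightarrow> ('a::complex_inner \<Rightarrow> 'a) \<Rightarrow> real"
  where "q_numerical_radius q T =
    (let W = {cmod (cinner (T x) y) | x y.
                norm x = 1 \<and> norm y = 1 \<and> cinner x y = complex_of_real q}
     in if W = {} then 0 else Sup W)"

end

theory Submission
  imports Defs
begin

text \<open>
  Let \<open>\<parallel>x\<parallel> = \<parallel>y\<parallel> = 1\<close> and \<open>\<langle>x,y\<rangle> = q\<close>, and put \<open>s = sqrt (1 - q\<^sup>2)\<close>. Then \<open>y = q x + w\<close> with
  \<open>w\<close> orthogonal to \<open>x\<close> and \<open>\<parallel>w\<parallel> = s\<close>. In \<open>\<langle>T x,w\<rangle>\<close> only the component of \<open>T x\<close>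
  orthogonal to \<open>x\<close> counts. Its norm \<open>c\<close> satisfies \<open>a\<^sup>2 + c\<^sup>2 = \<parallel>T x\<parallel>\<^sup>2\<close> for
  \<open>a = \<bar>\<langle>T x,x\<rangle>\<bar>\<close>, so
  \<open>\<bar>\<langle>T x,y\<rangle>\<bar>\<^sup>2 \<le> (q a + s c)\<^sup>2 \<le> q\<^sup>2 a\<^sup>2 + (q s + s\<^sup>2) \<parallel>T x\<parallel>\<^sup>2\<close>,
  where \<open>2 a c \<le> a\<^sup>2 + c\<^sup>2\<close> bounds the mixed term (lemma \<open>cmod_cinner_sq_le\<close>), and
  \<open>\<parallel>T x\<parallel> \<le> \<parallel>T\<parallel>\<close>.
  The remaining term \<open>a\<^sup>2\<close> is controlled by the adjoint: \<open>a\<close> is at most \<open>\<parallel>T x\<parallel>\<close> and, moving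
  \<open>T\<close> to the other side, at most \<open>\<parallel>T\<^sup>* x\<parallel>\<close>. Hence \<open>2 a\<^sup>2\<close> is at most
  \<open>\<parallel>T x\<parallel>\<^sup>2 + \<parallel>T\<^sup>* x\<parallel>\<^sup>2 = \<langle>(T\<^sup>* T + T T\<^sup>*) x, x\<rangle>\<close>, which is at most
  \<open>\<parallel>T\<^sup>* T + T T\<^sup>*\<parallel>\<close> (lemma \<open>cmod_cinner_self_sq_le\<close>).

  The adjoint is given by a definite description, so its existence has to be proved. It comes
  from the Riesz representation theorem (lemma \<open>riesz_real\<close>), which is obtained from
  completeness by minimizing \<open>\<parallel>x\<parallel>\<^sup>2 - 2 g x\<close> for a bounded functional \<open>g\<close>.
\<close>

section \<open>Complex inner products\<close>

lemma cinner_add_right: "cinner x (y + z) = cinner x y + cinner x z"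
  by (metis cinner_add_left cinner_commute complex_cnj_add)

lemma cinner_scaleC_right: "cinner x (c *\<^sub>C y) = cnj c * cinner x y"
  by (metis cinner_scaleC_left cinner_commute complex_cnj_mult)

lemma cinner_scaleR_left: "cinner (r *\<^sub>R x) y = of_real r * cinner x y"
  by (simp add: scaleR_scaleC cinner_scaleC_left)

lemma cinner_scaleR_right: "cinner x (r *\<^sub>R y) = of_real r * cinner x y"
  by (simp add: scaleR_scaleC cinner_scaleC_right)

lemma cinner_minus_left: "cinner (- x) y = - cinner x y"
  using cinner_scaleR_left[of "-1" x y] by simp

lemma cinner_minus_right: "cinner x (- y) = - cinner x y"
  using cinner_scaleR_right[of x "-1" y] by simp

lemma cinner_diff_left: "cinner (x - y) z = cinner x z - cinner y z"
  using cinner_add_left[of x "- y" z] by (simp add: cinner_minus_left)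

lemma cinner_diff_right: "cinner x (y - z) = cinner x y - cinner x z"
  using cinner_add_right[of x y "- z"] by (simp add: cinner_minus_right)

lemma Re_cinner_commute: "Re (cinner x y) = Re (cinner y x)"
  using arg_cong[OF cinner_commute[of x y], of Re] by simp

lemma cinner_self: "cinner x x = of_real ((norm x)\<^sup>2)"
proof (rule complex_eqI)
  show "Re (cinner x x) = Re (of_real ((norm x)\<^sup>2))"
    by (simp add: norm_eq_sqrt_cinner cinner_ge_zero)
  show "Im (cinner x x) = Im (of_real ((norm x)\<^sup>2))"
    using arg_cong[OF cinner_commute[of x x], of Im] by simp
qed

lemma norm_add_sq: "(norm (x + y))\<^sup>2 = (norm x)\<^sup>2 + (norm y)\<^sup>2 + 2 * Re (cinner x y)"
  for x y :: "'a::complex_inner"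
proof -
  have "(norm (x + y))\<^sup>2 = Re (cinner (x + y) (x + y))" by (simp add: cinner_self)
  also have "\<dots> = (norm x)\<^sup>2 + (norm y)\<^sup>2 + 2 * Re (cinner x y)"
    unfolding cinner_add_left cinner_add_right
    using Re_cinner_commute[of y x] by (simp add: cinner_self)
  finally show ?thesis .
qed

lemma norm_diff_sq: "(norm (x - y))\<^sup>2 = (norm x)\<^sup>2 + (norm y)\<^sup>2 - 2 * Re (cinner x y)"
  for x y :: "'a::complex_inner"
  using norm_add_sq[of x "- y"] by (simp add: cinner_minus_right)

lemma norm_scaleC: "norm (c *\<^sub>C x) = cmod c * norm x"
  for x :: "'a::complex_inner"
proof -
  have "complex_of_real ((norm (c *\<^sub>C x))\<^sup>2) = (c * cnj c) * cinner x x"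
    unfolding cinner_self[symmetric] cinner_scaleC_left cinner_scaleC_right
    by (simp only: mult_ac)
  also have "\<dots> = of_real ((cmod c * norm x)\<^sup>2)"
    by (simp only: cinner_self complex_norm_square[symmetric] of_real_mult power_mult_distrib)
  finally have "complex_of_real ((norm (c *\<^sub>C x))\<^sup>2) = of_real ((cmod c * norm x)\<^sup>2)" .
  then show ?thesis
    by (simp only: of_real_eq_iff) (simp add: power2_eq_iff_nonneg)
qed

lemma eq_if_cinner_eq:
  assumes "\<And>h. cinner h x = cinner h y"
  shows "x = y"
proof -
  have "cinner (x - y) (x - y) = 0"
    using assms by (simp add: cinner_diff_right)
  then show ?thesis by (simp add: cinner_eq_zero_iff)
qed

text \<open>For the real part, Cauchy--Schwarz is the squared triangle inequality.
  Rotating \<open>x\<close> by a unimodular scalar turns the inner product into its modulus.\<close>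

lemma cmod_cinner_le: "cmod (cinner x y) \<le> norm x * norm y"
proof (cases "cinner x y = 0")
  case False
  define c where "c = cnj (cinner x y) / cmod (cinner x y)"
  have c: "cmod c = 1" using False by (simp add: c_def norm_divide)
  have "cinner (c *\<^sub>C x) y = cinner x y * cnj (cinner x y) / cmod (cinner x y)"
    by (simp add: cinner_scaleC_left c_def mult.commute)
  also have "\<dots> = of_real ((cmod (cinner x y))\<^sup>2) / of_real (cmod (cinner x y))"
    by (simp only: complex_norm_square)
  also have "\<dots> = of_real ((cmod (cinner x y))\<^sup>2 / cmod (cinner x y))"
    by (rule of_real_divide[symmetric])
  also have "(cmod (cinner x y))\<^sup>2 / cmod (cinner x y) = cmod (cinner x y)"
    by (simp add: power2_eq_square)
  finally have "cinner (c *\<^sub>C x) y = cmod (cinner x y)" .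
  moreover have "(norm (c *\<^sub>C x + y))\<^sup>2 \<le> (norm (c *\<^sub>C x) + norm y)\<^sup>2"
    by (intro power_mono norm_triangle_ineq norm_ge_zero)
  ultimately show ?thesis
    by (simp add: norm_add_sq norm_scaleC c power2_sum)
qed simp

section \<open>Riesz representation and the adjoint\<close>

text \<open>A minimizer \<open>u\<close> of \<open>J x = \<parallel>x\<parallel>\<^sup>2 - 2 g x\<close> represents \<open>g\<close>, because the derivative of \<open>J\<close>
  at \<open>u\<close> in direction \<open>h\<close> is \<open>2 (Re \<langle>u,h\<rangle> - g h)\<close>. Minimizing sequences are Cauchy by
  the parallelogram law, applied to two terms and their midpoint.\<close>

lemma riesz_real:
  fixes g :: "'a::chilbert_space \<Rightarrow> real"
  assumes g: "bounded_linear g"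
  obtains u where "\<And>h. g h = Re (cinner h u)"
proof -
  define J where "J x = (norm x)\<^sup>2 - 2 * g x" for x
  define m where "m = Inf (range J)"
  interpret g: bounded_linear g by (rule g)
  have "- (onorm g)\<^sup>2 \<le> J x" for x
  proof -
    have "g x \<le> onorm g * norm x" using onorm[OF g, of x] by simp
    moreover have "0 \<le> (norm x - onorm g)\<^sup>2" by simp
    ultimately show ?thesis by (simp add: J_def power2_diff mult.commute)
  qed
  then have bdd: "bdd_below (range J)" by (auto intro!: bdd_belowI2)
  have m_le: "m \<le> J x" for x
    unfolding m_def by (rule cInf_lower[OF _ bdd]) simp
  have "\<exists>x. J x < m + 1 / Suc n" for n
  proof -
    have "Inf (range J) < m + 1 / Suc n" by (simp add: m_def)
    then show ?thesis using cInf_lessD[of "range J"] by blast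
  qed
  then obtain X where X: "\<And>n. J (X n) < m + 1 / Suc n" by metis
  have gap: "(norm (a - b))\<^sup>2 \<le> 2 * (J a - m) + 2 * (J b - m)" for a b
  proof -
    define mid where "mid = (1/2) *\<^sub>R (a + b)"
    have "4 * (norm mid)\<^sup>2 = (norm (a + b))\<^sup>2"
      by (simp add: mid_def power_divide)
    moreover have "2 * g mid = g a + g b"
      by (simp add: mid_def g.scaleR g.add)
    ultimately have "(norm (a - b))\<^sup>2 = 2 * J a + 2 * J b - 4 * J mid"
      by (simp add: J_def norm_add_sq norm_diff_sq)
    then show ?thesis using m_le[of mid] by simp
  qed
  have "Cauchy X"
  proof (rule metric_CauchyI)
    fix e :: real assume "0 < e"
    then obtain N where N: "1 / Suc N < e\<^sup>2 / 4"
      using nat_approx_posE[of "e\<^sup>2 / 4"] by auto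
    have "dist (X k) (X l) < e" if "k \<ge> N" "l \<ge> N" for k l
    proof -
      have small: "J (X n) - m < e\<^sup>2 / 4" if "n \<ge> N" for n
      proof -
        have "1 / real (Suc n) \<le> 1 / real (Suc N)" using that by (simp add: frac_le)
        then show ?thesis using X[of n] N by linarith
      qed
      have "(norm (X k - X l))\<^sup>2 < e\<^sup>2"
        using gap[of "X k" "X l"] small[OF that(1)] small[OF that(2)] by (simp add: field_simps)
      then show ?thesis
        using \<open>0 < e\<close> by (simp add: dist_norm power_less_imp_less_base)
    qed
    then show "\<exists>N. \<forall>k\<ge>N. \<forall>l\<ge>N. dist (X k) (X l) < e" by blast
  qed
  then obtain u where u: "X \<longlonglongrightarrow> u"
    by (auto simp: Cauchy_convergent_iff convergent_def)
  have "(\<lambda>n. J (X n)) \<longlonglongrightarrow> J u"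
    unfolding J_def by (intro tendsto_intros g.tendsto u)
  moreover have "(\<lambda>n. m + 1 / Suc n) \<longlonglongrightarrow> m + 0"
    by (intro tendsto_intros LIMSEQ_Suc[OF lim_1_over_n])
  ultimately have "J u \<le> m + 0"
    using X by (intro LIMSEQ_le[of "\<lambda>n. J (X n)" _ "\<lambda>n. m + 1 / Suc n"]) (auto intro: less_imp_le)
  then have min: "J u \<le> J x" for x using m_le[of x] by simp
  have "g h = Re (cinner h u)" for h
  proof -
    define d where "d = Re (cinner u h) - g h"
    define k where "k = (norm h)\<^sup>2 + 1"
    \<comment> \<open>A step against the sign of \<open>d\<close>, short enough that the linear term of \<open>J\<close> wins.\<close>
    define t where "t = - d / k"
    have k: "k \<ge> 1" by (simp add: k_def)
    have "J (u + t *\<^sub>R h) = J u + t\<^sup>2 * (norm h)\<^sup>2 + 2 * t * d"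
      by (simp add: J_def norm_add_sq g.add g.scaleR cinner_scaleR_right d_def
          power_mult_distrib algebra_simps)
    then have "0 \<le> t\<^sup>2 * (k - 1) + 2 * t * d" using min[of "u + t *\<^sub>R h"] by (simp add: k_def)
    also have "\<dots> = - (t\<^sup>2 * (k + 1))"
      using k by (simp add: t_def field_simps power2_eq_square)
    finally have "t\<^sup>2 * (k + 1) \<le> 0" by simp
    then have "t = 0" using k by (auto simp: mult_le_0_iff)
    then have "d = 0" using k by (simp add: t_def)
    then show ?thesis using Re_cinner_commute[of u h] by (simp add: d_def)
  qed
  then show thesis by (rule that)
qed

text \<open>For fixed \<open>y\<close>, represent the real part of \<open>\<lambda>h. \<langle>T h, y\<rangle>\<close>. Evaluating at \<open>i h\<close> recovers
  the imaginary part.\<close>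

lemma cinner_cadjoint:
  fixes T :: "'a::chilbert_space \<Rightarrow> 'a"
  assumes T: "bounded_clinear T"
  shows "cinner (T x) y = cinner x (cadjoint T y)"
proof -
  have bl: "bounded_linear T" and sc: "\<And>c x. T (c *\<^sub>C x) = c *\<^sub>C T x"
    using T by (auto simp: bounded_clinear_def)
  interpret T: bounded_linear T by (rule bl)
  have "\<exists>u. \<forall>h. cinner (T h) y = cinner h u" for y
  proof -
    have real_part: "bounded_linear (\<lambda>h. Re (cinner (T h) y))"
    proof (rule bounded_linear_intro[where K = "onorm T * norm y"])
      fix h
      have "norm (Re (cinner (T h) y)) \<le> cmod (cinner (T h) y)"
        by (simp add: abs_Re_le_cmod)
      also have "\<dots> \<le> norm (T h) * norm y" by (rule cmod_cinner_le)
      also have "\<dots> \<le> (onorm T * norm h) * norm y"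
        by (intro mult_right_mono onorm bl norm_ge_zero)
      finally show "norm (Re (cinner (T h) y)) \<le> norm h * (onorm T * norm y)"
        by (simp add: mult_ac)
    qed (simp_all add: T.add T.scaleR cinner_add_left cinner_scaleR_left)
    obtain u where u: "\<And>h. Re (cinner (T h) y) = Re (cinner h u)"
      using riesz_real[OF real_part] by blast
    have "cinner (T h) y = cinner h u" for h
      using u[of h] u[of "\<i> *\<^sub>C h"]
      by (simp add: sc cinner_scaleC_left complex_eq_iff)
    then show ?thesis by blast
  qed
  then obtain S where S: "\<And>x y. cinner (T x) y = cinner x (S y)" by metis
  have "cadjoint T = S"
    unfolding cadjoint_def
  proof (rule the_equality)
    show "\<forall>x y. cinner (T x) y = cinner x (S y)" using S by blast
    fix S' assume S': "\<forall>x y. cinner (T x) y = cinner x (S' y)"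
    have "cinner h (S' y) = cinner h (S y)" for h y
      using S[of h y] S' by simp
    then show "S' = S" by (rule ext[OF eq_if_cinner_eq])
  qed
  then show ?thesis using S by blast
qed

lemma bounded_linear_cadjoint:
  fixes T :: "'a::chilbert_space \<Rightarrow> 'a"
  assumes T: "bounded_clinear T"
  shows "bounded_linear (cadjoint T)"
proof (rule bounded_linear_intro[where K = "onorm T"])
  note adj = cinner_cadjoint[OF T, symmetric]
  have bl: "bounded_linear T" using T by (simp add: bounded_clinear_def)
  show "cadjoint T (x + y) = cadjoint T x + cadjoint T y" for x y
    by (rule eq_if_cinner_eq) (simp add: adj cinner_add_right)
  show "cadjoint T (r *\<^sub>R x) = r *\<^sub>R cadjoint T x" for r x
    by (rule eq_if_cinner_eq) (simp add: adj cinner_scaleR_right)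
  show "norm (cadjoint T y) \<le> norm y * onorm T" for y
  proof (cases "cadjoint T y = 0")
    case True
    then show ?thesis by (simp add: onorm_pos_le[OF bl])
  next
    case False
    let ?z = "cadjoint T y"
    have "(norm ?z)\<^sup>2 = cmod (cinner (T ?z) y)"
      by (simp add: cinner_cadjoint[OF T] cinner_self norm_power)
    also have "\<dots> \<le> norm (T ?z) * norm y" by (rule cmod_cinner_le)
    also have "\<dots> \<le> (onorm T * norm ?z) * norm y"
      by (intro mult_right_mono onorm bl norm_ge_zero)
    finally have "norm ?z * norm ?z \<le> (norm y * onorm T) * norm ?z"
      by (simp add: power2_eq_square mult_ac)
    then show ?thesis using False by simp
  qed
qed

section \<open>The bound on the q-numerical radius\<close>

lemma bounded_linear_cadjoint_anticommutator:
  fixes T :: "'a::chilbert_space \<Rightarrow> 'a"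
  assumes T: "bounded_clinear T"
  shows "bounded_linear (\<lambda>x. cadjoint T (T x) + T (cadjoint T x))"
proof -
  have "bounded_linear T" using T by (simp add: bounded_clinear_def)
  then show ?thesis
    using bounded_linear_cadjoint[OF T]
    by (intro bounded_linear_add bounded_linear_compose[of "cadjoint T" T]
        bounded_linear_compose[of T "cadjoint T"])
qed

lemma cmod_cinner_self_sq_le:
  fixes T :: "'a::chilbert_space \<Rightarrow> 'a"
  assumes T: "bounded_clinear T" and x: "norm x = 1"
  shows "(cmod (cinner (T x) x))\<^sup>2 \<le> onorm (\<lambda>x. cadjoint T (T x) + T (cadjoint T x)) / 2"
proof -
  let ?A = "\<lambda>x. cadjoint T (T x) + T (cadjoint T x)"
  have "(cmod (cinner (T x) x))\<^sup>2 \<le> (norm (T x))\<^sup>2"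
    using cmod_cinner_le[of "T x" x] x by (intro power_mono) auto
  moreover have "(cmod (cinner (T x) x))\<^sup>2 \<le> (norm (cadjoint T x))\<^sup>2"
    using cmod_cinner_le[of x "cadjoint T x"] x
    by (intro power_mono) (auto simp: cinner_cadjoint[OF T])
  moreover have "(norm (T x))\<^sup>2 + (norm (cadjoint T x))\<^sup>2 = Re (cinner x (?A x))"
  proof -
    have "cinner x (cadjoint T (T x)) = of_real ((norm (T x))\<^sup>2)"
      by (simp add: cinner_cadjoint[OF T, symmetric] cinner_self)
    moreover have "cinner x (T (cadjoint T x)) = of_real ((norm (cadjoint T x))\<^sup>2)"
      by (subst cinner_commute) (simp add: cinner_cadjoint[OF T] cinner_self)
    ultimately show ?thesis by (simp add: cinner_add_right)
  qed
  moreover have "Re (cinner x (?A x)) \<le> onorm ?A"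
  proof -
    have "Re (cinner x (?A x)) \<le> norm x * norm (?A x)"
      by (rule order_trans[OF complex_Re_le_cmod cmod_cinner_le])
    also have "\<dots> \<le> onorm ?A"
      using onorm[OF bounded_linear_cadjoint_anticommutator[OF T], of x] x by simp
    finally show ?thesis .
  qed
  ultimately show ?thesis by linarith
qed

text \<open>Split \<open>v\<close> and \<open>y\<close> along \<open>x\<close>: with \<open>v' = v - \<langle>v,x\<rangle> x\<close> and \<open>w = y - q x\<close> one has
  \<open>\<langle>v,y\<rangle> = q \<langle>v,x\<rangle> + \<langle>v',w\<rangle>\<close>, and Pythagoras gives \<open>\<parallel>v'\<parallel>\<close> and \<open>\<parallel>w\<parallel>\<close>.\<close>

lemma cmod_cinner_sq_le:
  fixes v x y :: "'a::complex_inner"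
  assumes x: "norm x = 1" and y: "norm y = 1" and xy: "cinner x y = complex_of_real q"
    and q: "0 \<le> q" "q \<le> 1"
  shows "(cmod (cinner v y))\<^sup>2
    \<le> q\<^sup>2 * (cmod (cinner v x))\<^sup>2 + (1 - q\<^sup>2 + q * sqrt (1 - q\<^sup>2)) * (norm v)\<^sup>2"
proof -
  define a where "a = cmod (cinner v x)"
  define s where "s = sqrt (1 - q\<^sup>2)"
  define w where "w = y - q *\<^sub>R x"
  define v' where "v' = v - cinner v x *\<^sub>C x"
  define c where "c = norm v'"
  have q2: "q\<^sup>2 \<le> 1" using q by (simp add: power_le_one)
  have s: "s\<^sup>2 = 1 - q\<^sup>2" "s \<ge> 0" using q2 by (simp_all add: s_def)
  have xx: "cinner x x = 1" by (simp add: cinner_self x)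
  have w: "norm w = s"
  proof -
    have "cinner y x = of_real q" by (subst cinner_commute) (simp add: xy)
    then have "(norm w)\<^sup>2 = s\<^sup>2"
      unfolding w_def norm_diff_sq cinner_scaleR_right
      using s(1) by (simp add: x y power2_eq_square)
    then show ?thesis by (rule power2_eq_imp_eq[OF _ norm_ge_zero s(2)])
  qed
  have c: "c\<^sup>2 + a\<^sup>2 = (norm v)\<^sup>2"
    unfolding c_def v'_def norm_diff_sq norm_scaleC x a_def cinner_scaleC_right
    using cmod_power2[of "cinner v x"] by (simp add: power2_eq_square)
  have "cinner v y = of_real q * cinner v x + cinner v' w"
    by (simp add: v'_def w_def cinner_diff_left cinner_diff_right cinner_scaleC_left
        cinner_scaleR_right xx xy algebra_simps)
  then have "cmod (cinner v y) \<le> q * a + cmod (cinner v' w)"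
    using norm_triangle_ineq[of "of_real q * cinner v x" "cinner v' w"] q
    by (simp add: a_def norm_mult)
  also have "\<dots> \<le> q * a + s * c"
    using cmod_cinner_le[of v' w] by (simp add: w c_def mult.commute)
  finally have "(cmod (cinner v y))\<^sup>2 \<le> (q * a + s * c)\<^sup>2"
    by (intro power_mono) auto
  also have "\<dots> = q\<^sup>2 * a\<^sup>2 + q * s * (2 * a * c) + s\<^sup>2 * c\<^sup>2"
    by (simp add: power2_eq_square algebra_simps)
  also have "\<dots> \<le> q\<^sup>2 * a\<^sup>2 + q * s * (norm v)\<^sup>2 + s\<^sup>2 * (norm v)\<^sup>2"
  proof (intro add_mono order_refl mult_left_mono)
    show "2 * a * c \<le> (norm v)\<^sup>2" using sum_squares_bound[of a c] c by simp
    show "c\<^sup>2 \<le> (norm v)\<^sup>2" using c by (simp flip: c)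
  qed (use q q2 s in auto)
  also have "\<dots> = q\<^sup>2 * a\<^sup>2 + (1 - q\<^sup>2 + q * s) * (norm v)\<^sup>2"
    by (simp add: s algebra_simps)
  finally show ?thesis by (simp add: a_def s_def)
qed

theorem corollary2p8:
  fixes T :: "'a::chilbert_space \<Rightarrow> 'a" and q :: real
  assumes "bounded_clinear T" and "q \<in> {0..1}"
  shows "(q_numerical_radius q T)\<^sup>2
    \<le> q\<^sup>2 / 2 * onorm (\<lambda>x. cadjoint T (T x) + T (cadjoint T x))
      + (1 - q\<^sup>2 + q * sqrt (1 - q\<^sup>2)) * (onorm T)\<^sup>2"
    (is "_ \<le> ?R")
proof -
  let ?A = "\<lambda>x. cadjoint T (T x) + T (cadjoint T x)"
  define W where "W = {cmod (cinner (T x) y) | x y.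
    norm x = 1 \<and> norm y = 1 \<and> cinner x y = complex_of_real q}"
  have bl: "bounded_linear T" using assms(1) by (simp add: bounded_clinear_def)
  have q: "0 \<le> q" "q \<le> 1" using assms(2) by auto
  have coeff: "0 \<le> 1 - q\<^sup>2 + q * sqrt (1 - q\<^sup>2)"
    using q by (simp add: power_le_one)
  have bound: "r\<^sup>2 \<le> ?R" if in_W: "r \<in> W" for r
  proof -
    obtain x y where r: "r = cmod (cinner (T x) y)" and x: "norm x = 1" and y: "norm y = 1"
      and xy: "cinner x y = complex_of_real q"
      using in_W unfolding W_def by blast
    have "q\<^sup>2 * (cmod (cinner (T x) x))\<^sup>2 \<le> q\<^sup>2 * (onorm ?A / 2)"
      by (intro mult_left_mono cmod_cinner_self_sq_le assms(1) x) simp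
    moreover have "(norm (T x))\<^sup>2 \<le> (onorm T)\<^sup>2"
      using onorm[OF bl, of x] x by (intro power_mono) auto
    then have "(1 - q\<^sup>2 + q * sqrt (1 - q\<^sup>2)) * (norm (T x))\<^sup>2
        \<le> (1 - q\<^sup>2 + q * sqrt (1 - q\<^sup>2)) * (onorm T)\<^sup>2"
      using coeff by (rule mult_left_mono)
    ultimately show ?thesis
      using cmod_cinner_sq_le[OF x y xy q, of "T x"] r by simp
  qed
  show ?thesis
  proof (cases "W = {}")
    case True
    have "0 \<le> ?R"
      using coeff onorm_pos_le[OF bounded_linear_cadjoint_anticommutator[OF assms(1)]] by simp
    then show ?thesis
      using True by (simp add: q_numerical_radius_def W_def Let_def)
  next
    case False
    then obtain r where r: "r \<in> W" by blast
    have le: "t \<le> sqrt ?R" if "t \<in> W" for t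
      using bound[OF that] by (rule real_le_rsqrt)
    have "0 \<le> r" using r by (auto simp: W_def)
    also have "r \<le> Sup W" using r le by (intro cSup_upper bdd_aboveI)
    finally have "0 \<le> Sup W" .
    moreover have "Sup W \<le> sqrt ?R" using False le by (intro cSup_least)
    ultimately have "(Sup W)\<^sup>2 \<le> (sqrt ?R)\<^sup>2" by (intro power_mono)
    also have "\<dots> = ?R" using bound[OF r] zero_le_power2[of r] by (simp only: real_sqrt_pow2)
    finally show ?thesis
      using False by (simp add: q_numerical_radius_def W_def[symmetric] Let_def)
  qed
qed

end
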